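(* Let $n\ge 1$ and let $[n]=\{1,2,\ldots,n\}$ be the chain with its usual total order. Let $Z_{[n]}$ be its zeta matrix, i.e. the $n\times n$ matrix with $(i,j)$ entry equal to $1$ if $i\le j$ and $0$ otherwise, let $M_{[n]}=Z_{[n]}^{-1}$, and set $\mathfrak{Z}_{[n]}=Z_{[n]}+Z_{[n]}^t$ and $\mathfrak{M}_{[n]}=M_{[n]}+M_{[n]}^t$. Then $$\det(\mathfrak{Z}_{[n]}) = \det(\mathfrak{M}_{[n]}) = n+1.$$
   Context: The superscript $t$ denotes transpose. *)

theory Defs
  imports
    "Jordan_Normal_Form.Determinant"
    "Jordan_Normal_Form.Gauss_Jordan_Elimination"
begin

(* Matrix indices start at 0: row and column i stand for the element i + 1 of the
   chain {1, ..., n}.  The shift does not affect the order. *)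
definition zeta_mat :: "nat \<Rightarrow> real mat" where
  "zeta_mat n = mat n n (\<lambda>(i, j). if i \<le> j then 1 else 0)"

(* mat_inverse returns None on singular matrices; moebius_mat_inverse below shows
   that this does not happen here. *)
definition moebius_mat :: "nat \<Rightarrow> real mat" where
  "moebius_mat n = the (mat_inverse (zeta_mat n))"

definition zeta_sym_mat :: "nat \<Rightarrow> real mat" where
  "zeta_sym_mat n = zeta_mat n + transpose_mat (zeta_mat n)"

definition moebius_sym_mat :: "nat \<Rightarrow> real mat" where
  "moebius_sym_mat n = moebius_mat n + transpose_mat (moebius_mat n)"

lemma zeta_mat_carrier: "zeta_mat n \<in> carrier_mat n n"
  by (simp add: zeta_mat_def)

lemma det_zeta_mat: "det (zeta_mat n) = 1"
proof -
  have "upper_triangular (zeta_mat n)"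
    by (auto simp: zeta_mat_def upper_triangular_def)
  then have "det (zeta_mat n) = prod_list (diag_mat (zeta_mat n))"
    using zeta_mat_carrier by (rule det_upper_triangular)
  also have "diag_mat (zeta_mat n) = replicate n 1"
    by (rule nth_equalityI) (simp_all add: diag_mat_def zeta_mat_def)
  also have "prod_list \<dots> = 1"
    by (induction n) simp_all
  finally show ?thesis .
qed

lemma moebius_mat_inverse:
  "moebius_mat n \<in> carrier_mat n n"
  "zeta_mat n * moebius_mat n = 1\<^sub>m n"
  "moebius_mat n * zeta_mat n = 1\<^sub>m n"
proof -
  have "zeta_mat n \<in> Units (ring_mat TYPE(real) n ())"
    by (rule det_non_zero_imp_unit[OF zeta_mat_carrier]) (simp add: det_zeta_mat)
  then obtain B where B: "mat_inverse (zeta_mat n) = Some B"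
    using mat_inverse(1)[OF zeta_mat_carrier, of n "()"]
    by (cases "mat_inverse (zeta_mat n)") simp_all
  then show "moebius_mat n \<in> carrier_mat n n"
    "zeta_mat n * moebius_mat n = 1\<^sub>m n" "moebius_mat n * zeta_mat n = 1\<^sub>m n"
    using mat_inverse(2)[OF zeta_mat_carrier B] by (simp_all add: moebius_mat_def)
qed

end

theory Submission
  imports Defs
begin

text \<open>
  Since \<open>M (Z + Z\<^sup>t) M\<^sup>t = M\<^sup>t + M\<close> and \<open>det M = 1\<close>, the two determinants agree.
  The matrix \<open>Z + Z\<^sup>t\<close> is the sum of the identity and the all-ones matrix. Subtracting the
  first row from all others and then adding all columns to the first is conjugation by
  a unitriangular matrix, and it yields an upper triangular matrix with diagonal
  \<open>n + 1, 1, \<dots>, 1\<close>.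
\<close>

lemma det_moebius_mat: "det (moebius_mat n) = 1"
proof -
  have "det (zeta_mat n * moebius_mat n) = 1"
    by (simp add: moebius_mat_inverse)
  then show ?thesis
    by (simp add: det_mult[OF zeta_mat_carrier moebius_mat_inverse(1)] det_zeta_mat)
qed

text \<open>A congruence multiplies the determinant by the square of
  \<open>det (moebius_mat n)\<close>, so this form reduces the Moebius case to the zeta
  case.\<close>

lemma moebius_sym_mat_eq:
  "moebius_sym_mat n = moebius_mat n * zeta_sym_mat n * (moebius_mat n)\<^sup>T"
proof -
  let ?Z = "zeta_mat n" and ?M = "moebius_mat n"
  note car = zeta_mat_carrier[of n] moebius_mat_inverse(1)[of n]
    transpose_carrier_mat[THEN iffD2, OF zeta_mat_carrier[of n]]
    transpose_carrier_mat[THEN iffD2, OF moebius_mat_inverse(1)[of n]]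
  \<comment> \<open>Transposing \<open>?M * ?Z = 1\<^sub>m n\<close> reverses the factors.\<close>
  have ZM: "?Z\<^sup>T * ?M\<^sup>T = 1\<^sub>m n"
    using transpose_mult[OF car(2,1)] by (simp add: moebius_mat_inverse)
  have "?M * zeta_sym_mat n = 1\<^sub>m n + ?M * ?Z\<^sup>T"
    unfolding zeta_sym_mat_def using car
    by (simp add: mult_add_distrib_mat[of _ n n] moebius_mat_inverse)
  also have "\<dots> * ?M\<^sup>T = ?M\<^sup>T + ?M * ?Z\<^sup>T * ?M\<^sup>T"
    using car by (simp add: add_mult_distrib_mat[of _ n n])
  also have "?M * ?Z\<^sup>T * ?M\<^sup>T = ?M"
    using car ZM by (simp add: assoc_mult_mat[of _ n n _ n _ n])
  also have "?M\<^sup>T + ?M = moebius_sym_mat n"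
    unfolding moebius_sym_mat_def using car by (simp add: comm_add_mat)
  finally show ?thesis by simp
qed

lemma det_zeta_sym_mat:
  assumes "n \<ge> 1"
  shows "det (zeta_sym_mat n) = real n + 1"
proof -
  \<comment> \<open>Right multiplication by \<open>F\<close> adds all columns to the first; left
    multiplication by its inverse subtracts the first row from all others. \<open>T\<close> is the
    result of doing both.\<close>
  define F :: "real mat" where
    "F = mat n n (\<lambda>(i, j). if i = j \<or> j = 0 then 1 else 0)"
  define T :: "real mat" where
    "T = mat n n (\<lambda>(i, j). if i = 0 \<and> j = 0 then real n + 1
                            else if i = 0 \<or> i = j then 1 else 0)"
  \<comment> \<open>Of \<open>i \<le> j\<close> and \<open>j \<le> i\<close>, exactly one holds off
    the diagonal and both hold on it.\<close>
  have A: "zeta_sym_mat n = mat n n (\<lambda>(i, j). (if i = j then 1 else 0) + 1)"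
    by (rule eq_matI) (auto simp: zeta_sym_mat_def zeta_mat_def)
  have car: "zeta_sym_mat n \<in> carrier_mat n n" "F \<in> carrier_mat n n" "T \<in> carrier_mat n n"
    by (simp_all add: A F_def T_def)
  \<comment> \<open>Conjugation in this form avoids computing the inverse of
    \<open>F\<close>.\<close>
  have conj: "zeta_sym_mat n * F = F * T"
  proof (rule eq_matI)
    fix i j assume "i < dim_row (F * T)" "j < dim_col (F * T)"
    then have ij: "i < n" "j < n" by (simp_all add: F_def T_def)
    have "(zeta_sym_mat n * F) $$ (i, j) =
        (\<Sum>k<n. ((if i = k then 1 else 0) + 1) * (if k = j \<or> j = 0 then 1 else 0))"
      using ij by (simp add: A F_def scalar_prod_def atLeast0LessThan)
    \<comment> \<open>Column 0 of \<open>F\<close> is all ones and gives a row sum; any other column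
      \<open>j\<close> is a unit vector and picks out one entry.\<close>
    also have "\<dots> = (if j = 0 then real n + 1 else (if i = j then 1 else 0) + 1)"
    proof (cases "j = 0")
      case True
      then show ?thesis using ij by (simp add: sum.distrib)
    next
      case False
      then show ?thesis using ij
        by (simp add: if_distrib[of "\<lambda>x. _ * x"] cong: if_cong)
    qed
    \<comment> \<open>Row \<open>i\<close> of \<open>F\<close> has ones exactly at positions 0 and
      \<open>i\<close>; these coincide when \<open>i = 0\<close>, so the second term is then
      dropped.\<close>
    also have "\<dots> = T $$ (0, j) + (if i = 0 then 0 else T $$ (i, j))"
      using ij by (simp add: T_def)
    also have "\<dots> = (\<Sum>k<n. (if k = 0 then T $$ (k, j) else 0) +
                               (if k = i then if i = 0 then 0 else T $$ (k, j) else 0))"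
      using ij by (simp add: sum.distrib)
    also have "\<dots> = (\<Sum>k<n. (if i = k \<or> k = 0 then 1 else 0) * T $$ (k, j))"
      by (rule sum.cong) auto
    also have "\<dots> = (F * T) $$ (i, j)"
      using ij car(3) by (simp add: F_def scalar_prod_def atLeast0LessThan)
    finally show "(zeta_sym_mat n * F) $$ (i, j) = (F * T) $$ (i, j)" .
  qed (simp_all add: A F_def T_def)
  have "det F = prod_list (diag_mat F)"
    by (rule det_lower_triangular[OF _ car(2)]) (simp add: F_def)
  also have "\<dots> = 1"
    by (simp add: prod_list_diag_prod F_def)
  finally have detF: "det F = 1" .
  have "det T = prod_list (diag_mat T)"
    by (rule det_upper_triangular[OF _ car(3)]) (simp add: T_def upper_triangular_def)
  also have "\<dots> = (\<Prod>i<n. T $$ (i, i))"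
    using car(3) by (simp add: prod_list_diag_prod atLeast0LessThan)
  also have "\<dots> = (\<Prod>i<n. if i = 0 then real n + 1 else 1)"
    by (rule prod.cong) (simp_all add: T_def)
  \<comment> \<open>As \<open>n \<ge> 1\<close>, index 0 lies in the range and contributes the only
    factor not fixed to 1.\<close>
  also have "\<dots> = real n + 1"
    using assms by simp
  finally have "det T = real n + 1" .
  moreover have "det (zeta_sym_mat n) * det F = det F * det T"
    by (simp flip: det_mult[OF car(1,2)] det_mult[OF car(2,3)] add: conj)
  ultimately show ?thesis by (simp add: detF)
qed

theorem lemma2:
  fixes n :: nat
  assumes "n \<ge> 1"
  shows "det (zeta_sym_mat n) = det (moebius_sym_mat n) \<and>
         det (moebius_sym_mat n) = real n + 1"
proof -
  have "zeta_sym_mat n \<in> carrier_mat n n"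
    by (simp add: zeta_sym_mat_def zeta_mat_carrier)
  then have "det (moebius_sym_mat n) = det (zeta_sym_mat n)"
    using moebius_mat_inverse(1)[of n]
    by (simp add: moebius_sym_mat_eq det_mult[of _ n] det_transpose det_moebius_mat)
  then show ?thesis
    by (simp add: det_zeta_sym_mat[OF assms])
qed

end
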